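(* Let $S$ be a finite set, let $F$ be the free group on $S$, and let $R$ be a finite set of words over $S \cup S^{-1}$ (the relators). Let $U = v_1\, r_1^{\epsilon_1}\, v_2\, r_2^{\epsilon_2} \cdots v_N\, r_N^{\epsilon_N}\, v_{N+1}$ be any reduced proof word (with $N \ge 1$, $r_i \in R$, $\epsilon_i \in \{1,-1\}$, and each $v_i$ a freely reduced word). Then $U$ can be generated from the empty word $\varepsilon$ by a finite sequence of relator append moves and conjugation moves; that is, some finite sequence of such moves starting from $\varepsilon$ produces a marked word which, after freely reducing each of its segments lying outside the marked relator occurrences, is equal to $U$.
   Context: A proof word is a formal (not freely reduced) product $\prod_{i=1}^{N} u_i^{-1} r_i^{\pm 1} u_i$ with $r_i \in R$ and $u_i \in F$, in which the occurrences of the relators $r_i^{\pm1}$ are kept marked (delimited) and are never cancelled against the surrounding letters. Writing such a product as $v_1\, r_1^{\pm1}\, v_2\, r_2^{\pm1} \cdots v_N\, r_N^{\pm1}\, v_{N+1}$, where $v_1$ is the word $u_1^{-1}$, $v_i$ is the word $u_{i-1}u_i^{-1}$ for $2 \le i \le N$, and $v_{N+1}$ is the word $u_N$, the proof word is called reduced if each of the words $v_1, \dots, v_{N+1}$ is freely reduced. Moves act on marked words of this kind (strings over $S \cup S^{-1}$ with some marked relator occurrences): a conjugation move replaces a marked word $W$ by $x^{-1} W x$ for some $x \in S \cup S^{-1}$ (the letters $x^{-1}, x$ lie outside the marked relators); a relator append move replaces $W$ by $W r^{\pm 1}$ for some $r \in R$, the appended copy of $r^{\pm1}$ being marked. Free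 reduction is only ever performed on the unmarked segments between (and before/after) the marked relator occurrences. *)

theory Defs
  imports Main
begin

text \<open>A letter \<open>(s, True)\<close> stands for \<open>s\<close> and \<open>(s, False)\<close> for its formal inverse.\<close>

type_synonym 'a letter = "'a \<times> bool"
type_synonym 'a word = "'a letter list"

definition letters :: "'a set \<Rightarrow> 'a letter set" where
  "letters S = S \<times> UNIV"

definition words_over :: "'a set \<Rightarrow> 'a word set" where
  "words_over S = lists (letters S)"

definition inv_letter :: "'a letter \<Rightarrow> 'a letter" where
  "inv_letter x = (fst x, \<not> snd x)"

definition inv_word :: "'a word \<Rightarrow> 'a word" where
  "inv_word w = rev (map inv_letter w)"

text \<open>The sign \<open>True\<close> stands for the exponent \<open>1\<close>, \<open>False\<close> for \<open>-1\<close>. Inverses are formal: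
  no cancellation takes place.\<close>

definition signed_word :: "'a word \<Rightarrow> bool \<Rightarrow> 'a word" where
  "signed_word w e = (if e then w else inv_word w)"

definition freely_reduced :: "'a word \<Rightarrow> bool" where
  "freely_reduced w \<longleftrightarrow> \<not> (\<exists>p x q. w = p @ [x, inv_letter x] @ q)"

text \<open>The elements of the free group on \<open>S\<close>, represented by their unique freely reduced words.\<close>

definition free_group_elements :: "'a set \<Rightarrow> 'a word set" where
  "free_group_elements S = {w \<in> words_over S. freely_reduced w}"

text \<open>A marked relator occurrence is a single token that carries the string \<open>r\<close> or its inverse;
  its letters are thereby shielded from cancellation.\<close>

datatype 'a token = Letter "'a letter" | Marked "'a word"

type_synonym 'a marked_word = "'a token list"

definition unmarked :: "'a word \<Rightarrow> 'a marked_word" where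
  "unmarked v = map Letter v"

text \<open>Two adjacent \<open>Letter\<close> tokens always belong to the same unmarked segment, so the following
  step is an elementary free cancellation inside one such segment.\<close>

inductive cancel_step :: "'a marked_word \<Rightarrow> 'a marked_word \<Rightarrow> bool" where
  "cancel_step (A @ [Letter x, Letter (inv_letter x)] @ B) (A @ B)"

definition segmentwise_free_reduction :: "'a marked_word \<Rightarrow> 'a marked_word \<Rightarrow> bool" where
  "segmentwise_free_reduction W U \<longleftrightarrow>
     cancel_step\<^sup>*\<^sup>* W U \<and> \<not> (\<exists>V. cancel_step U V)"

inductive move :: "'a set \<Rightarrow> 'a word set \<Rightarrow> 'a marked_word \<Rightarrow> 'a marked_word \<Rightarrow> bool"
  for S :: "'a set" and R :: "'a word set" where
  conjugation: "x \<in> letters S \<Longrightarrow> move S R W ([Letter (inv_letter x)] @ W @ [Letter x])"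
| relator_append: "r \<in> R \<Longrightarrow> move S R W (W @ [Marked (signed_word r e)])"

definition marked_product ::
  "nat \<Rightarrow> (nat \<Rightarrow> 'a word) \<Rightarrow> (nat \<Rightarrow> 'a word) \<Rightarrow> (nat \<Rightarrow> bool) \<Rightarrow> 'a marked_word" where
  "marked_product N v r e =
     concat (map (\<lambda>i. unmarked (v i) @ [Marked (signed_word (r i) (e i))]) [1..<Suc N])
     @ unmarked (v (Suc N))"

text \<open>The formal product of the \<open>N\<close> conjugates of \<open>r i\<close> (with sign \<open>e i\<close>) by \<open>u i\<close>.\<close>

definition proof_word ::
  "nat \<Rightarrow> (nat \<Rightarrow> 'a word) \<Rightarrow> (nat \<Rightarrow> 'a word) \<Rightarrow> (nat \<Rightarrow> bool) \<Rightarrow> 'a marked_word" where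
  "proof_word N u r e =
     concat (map (\<lambda>i. unmarked (inv_word (u i)) @ [Marked (signed_word (r i) (e i))]
                      @ unmarked (u i)) [1..<Suc N])"

text \<open>The unmarked segments of such a product, as formal concatenations.\<close>

definition segment :: "nat \<Rightarrow> (nat \<Rightarrow> 'a word) \<Rightarrow> nat \<Rightarrow> 'a word" where
  "segment N u i =
     (if i = 1 then inv_word (u 1)
      else if i = Suc N then u N
      else u (i - 1) @ inv_word (u i))"

lemma proof_word_eq_marked_product:
  assumes "1 \<le> N"
  shows "proof_word N u r e = marked_product N (segment N u) r e"
proof -
  define g where
    "g i = (if i = 1 then inv_word (u 1) else u (i - 1) @ inv_word (u i))" for i
  have "proof_word N u r e =
    concat (map (\<lambda>i. unmarked (g i) @ [Marked (signed_word (r i) (e i))]) [1..<Suc N])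
    @ unmarked (u N)"
    using assms
    by (induction N rule: dec_induct) (simp_all add: proof_word_def g_def unmarked_def)
  moreover have "map (\<lambda>i. unmarked (segment N u i) @ [Marked (signed_word (r i) (e i))]) [1..<Suc N]
    = map (\<lambda>i. unmarked (g i) @ [Marked (signed_word (r i) (e i))]) [1..<Suc N]"
    by (rule map_cong) (auto simp: segment_def g_def)
  moreover have "segment N u (Suc N) = u N"
    using assms by (simp add: segment_def)
  ultimately show ?thesis
    by (simp only: marked_product_def)
qed

definition reduced_proof_word :: "'a set \<Rightarrow> 'a word set \<Rightarrow> 'a marked_word \<Rightarrow> bool" where
  "reduced_proof_word S R U \<longleftrightarrow>
     (\<exists>N u r e. 1 \<le> N \<and>
        (\<forall>i\<in>{1..N}. r i \<in> R \<and> u i \<in> free_group_elements S) \<and>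
        U = proof_word N u r e \<and>
        (\<forall>i\<in>{1..Suc N}. freely_reduced (segment N u i)))"

end

theory Submission
  imports Defs "HOL-Library.Sublist"
begin

text \<open>A cancellation followed by a move can be replaced by the move followed by the cancellation, so
  cancellations may be interleaved with the moves. Conjugating a generated word \<open>W\<close> by \<open>u\<^sup>-\<^sup>1\<close>,
  appending the marked relator \<open>r\<close> and conjugating by \<open>u\<close> gives \<open>u\<^sup>-\<^sup>1 u W u\<^sup>-\<^sup>1 r u\<close>, which cancels to
  \<open>W u\<^sup>-\<^sup>1 r u\<close>; hence the factors of a proof word can be produced one after the other from left to
  right. When the segments of the proof word are freely reduced, no further cancellation applies to
  it, since a cancelling pair never straddles a marked relator.\<close>

lemma sublist_map_iff:
  assumes "inj f"
  shows "sublist (map f xs) (map f ys) \<longleftrightarrow> sublist xs ys"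
proof
  assume "sublist (map f xs) (map f ys)"
  then obtain xs' where "sublist xs' ys" and "map f xs = map f xs'"
    by (blast dest: sublist_map_rightE)
  then show "sublist xs ys"
    using assms by (simp add: inj_map_eq_map)
qed (rule map_mono_sublist)

lemma sublist_append_Cons_iff:
  assumes "z \<notin> set xs"
  shows "sublist xs (ys @ z # zs) \<longleftrightarrow> sublist xs ys \<or> sublist xs zs"
  using assms by (auto simp: sublist_append sublist_Cons_right prefix_Cons)

lemma inv_letter_inv_letter [simp]: "inv_letter (inv_letter x) = x"
  by (simp add: inv_letter_def)

lemma inv_letter_in_letters_iff [simp]: "inv_letter x \<in> letters S \<longleftrightarrow> x \<in> letters S"
  by (cases x) (simp add: inv_letter_def letters_def)

lemma inv_word_Nil [simp]: "inv_word [] = []"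
  by (simp add: inv_word_def)

lemma inv_word_Cons [simp]: "inv_word (x # w) = inv_word w @ [inv_letter x]"
  by (simp add: inv_word_def)

lemma inv_word_append [simp]: "inv_word (v @ w) = inv_word w @ inv_word v"
  by (simp add: inv_word_def)

lemma inv_word_inv_word [simp]: "inv_word (inv_word w) = w"
  by (induction w) simp_all

lemma inv_word_in_words_over_iff [simp]: "inv_word w \<in> words_over S \<longleftrightarrow> w \<in> words_over S"
  by (induction w) (auto simp: words_over_def)

lemma unmarked_Nil [simp]: "unmarked [] = []"
  by (simp add: unmarked_def)

lemma unmarked_Cons [simp]: "unmarked (x # w) = Letter x # unmarked w"
  by (simp add: unmarked_def)

lemma unmarked_append [simp]: "unmarked (v @ w) = unmarked v @ unmarked w"
  by (simp add: unmarked_def)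

lemma cancel_step_context:
  assumes "cancel_step W W'"
  shows "cancel_step (A @ W @ B) (A @ W' @ B)"
proof -
  obtain C x D where "W = C @ [Letter x, Letter (inv_letter x)] @ D" and "W' = C @ D"
    using assms by cases
  then show ?thesis
    using cancel_step.intros[of "A @ C" x "D @ B"] by simp
qed

lemma cancel_steps_context:
  "cancel_step\<^sup>*\<^sup>* W W' \<Longrightarrow> cancel_step\<^sup>*\<^sup>* (A @ W @ B) (A @ W' @ B)"
  by (induction rule: rtranclp_induct)
    (auto intro: rtranclp.rtrancl_into_rtrancl cancel_step_context)

lemma cancel_steps_inv_word_append_self:
  "cancel_step\<^sup>*\<^sup>* (unmarked (inv_word w) @ unmarked w) []"
proof (induction w)
  case (Cons x w)
  have "cancel_step (unmarked (inv_word (x # w)) @ unmarked (x # w))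
    (unmarked (inv_word w) @ unmarked w)"
    using cancel_step.intros[of "unmarked (inv_word w)" "inv_letter x" "unmarked w"] by simp
  also note Cons.IH
  finally show ?case .
qed simp

lemma move_postpone_cancel_steps:
  assumes "cancel_step\<^sup>*\<^sup>* W U" and "move S R U V"
  obtains W' where "move S R W W'" and "cancel_step\<^sup>*\<^sup>* W' V"
  using assms(2)
proof cases
  case (conjugation x)
  have "move S R W ([Letter (inv_letter x)] @ W @ [Letter x])"
    using conjugation(2) by (rule move.conjugation)
  moreover have "cancel_step\<^sup>*\<^sup>* ([Letter (inv_letter x)] @ W @ [Letter x]) V"
    unfolding conjugation(1) using assms(1) by (rule cancel_steps_context)
  ultimately show ?thesis
    by (rule that)
next
  case (relator_append r e)
  have "move S R W (W @ [Marked (signed_word r e)])"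
    using relator_append(2) by (rule move.relator_append)
  moreover have "cancel_step\<^sup>*\<^sup>* (W @ [Marked (signed_word r e)]) V"
    unfolding relator_append(1) using cancel_steps_context[OF assms(1), of "[]"] by simp
  ultimately show ?thesis
    by (rule that)
qed

definition generated :: "'a set \<Rightarrow> 'a word set \<Rightarrow> 'a marked_word \<Rightarrow> bool" where
  "generated S R U \<longleftrightarrow> (\<exists>W. (move S R)\<^sup>*\<^sup>* [] W \<and> cancel_step\<^sup>*\<^sup>* W U)"

lemma generated_Nil: "generated S R []"
  by (auto simp: generated_def)

lemma generated_cancel_steps:
  "generated S R U \<Longrightarrow> cancel_step\<^sup>*\<^sup>* U V \<Longrightarrow> generated S R V"
  unfolding generated_def by (blast intro: rtranclp_trans)

lemma generated_move:
  assumes "generated S R U" and "move S R U V"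
  shows "generated S R V"
proof -
  obtain W where "(move S R)\<^sup>*\<^sup>* [] W" and "cancel_step\<^sup>*\<^sup>* W U"
    using assms(1) by (auto simp: generated_def)
  moreover obtain W' where "move S R W W'" and "cancel_step\<^sup>*\<^sup>* W' V"
    using \<open>cancel_step\<^sup>*\<^sup>* W U\<close> assms(2) by (rule move_postpone_cancel_steps)
  ultimately show ?thesis
    unfolding generated_def by (blast intro: rtranclp.rtrancl_into_rtrancl)
qed

lemma generated_conjugation:
  assumes "generated S R U" and "w \<in> words_over S"
  shows "generated S R (unmarked (inv_word w) @ U @ unmarked w)"
  using assms(2)
proof (induction w rule: rev_induct)
  case Nil
  then show ?case using assms(1) by simp
next
  case (snoc x w)
  then have "generated S R (unmarked (inv_word w) @ U @ unmarked w)" and "x \<in> letters S"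
    by (auto simp: words_over_def)
  then have "generated S R ([Letter (inv_letter x)] @ (unmarked (inv_word w) @ U @ unmarked w)
      @ [Letter x])"
    by (blast intro: generated_move move.conjugation)
  then show ?case by simp
qed

lemma generated_append_conjugate:
  assumes "generated S R U" and "u \<in> words_over S" and "r \<in> R"
  shows "generated S R
    (U @ unmarked (inv_word u) @ [Marked (signed_word r e)] @ unmarked u)"
    (is "generated S R (U @ ?C)")
proof -
  have "generated S R (unmarked u @ U @ unmarked (inv_word u))"
    using generated_conjugation[of S R U "inv_word u"] assms(1,2) by simp
  then have "generated S R
      ((unmarked u @ U @ unmarked (inv_word u)) @ [Marked (signed_word r e)])"
    using assms(3) by (blast intro: generated_move move.relator_append)
  from generated_conjugation[OF this assms(2)]
  have "generated S R ((unmarked (inv_word u) @ unmarked u) @ U @ ?C)"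
    by simp
  moreover have "cancel_step\<^sup>*\<^sup>* ((unmarked (inv_word u) @ unmarked u) @ U @ ?C) (U @ ?C)"
    using cancel_steps_context[OF cancel_steps_inv_word_append_self, of "[]"] by simp
  ultimately show ?thesis
    by (rule generated_cancel_steps)
qed

lemma proof_word_0: "proof_word 0 u r e = []"
  by (simp add: proof_word_def)

lemma proof_word_Suc:
  "proof_word (Suc N) u r e = proof_word N u r e @ unmarked (inv_word (u (Suc N)))
     @ [Marked (signed_word (r (Suc N)) (e (Suc N)))] @ unmarked (u (Suc N))"
  by (simp add: proof_word_def)

lemma generated_proof_word:
  assumes "\<forall>i\<in>{1..N}. r i \<in> R \<and> u i \<in> words_over S"
  shows "generated S R (proof_word N u r e)"
  using assms
proof (induction N)
  case 0
  then show ?case by (simp add: proof_word_0 generated_Nil)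
next
  case (Suc N)
  then show ?case
    unfolding proof_word_Suc by (intro generated_append_conjugate) auto
qed

lemma freely_reduced_iff_sublist:
  "freely_reduced w \<longleftrightarrow> (\<forall>x. \<not> sublist [x, inv_letter x] w)"
  by (auto simp: freely_reduced_def sublist_def)

definition segmentwise_reduced :: "'a marked_word \<Rightarrow> bool" where
  "segmentwise_reduced W \<longleftrightarrow> (\<forall>x. \<not> sublist [Letter x, Letter (inv_letter x)] W)"

lemma segmentwise_reduced_iff_no_cancel_step:
  "segmentwise_reduced W \<longleftrightarrow> \<not> (\<exists>V. cancel_step W V)"
  by (auto simp: segmentwise_reduced_def sublist_def cancel_step.simps)

lemma segmentwise_reduced_unmarked_iff:
  "segmentwise_reduced (unmarked w) \<longleftrightarrow> freely_reduced w"
proof -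
  have "inj Letter"
    by (simp add: inj_def)
  then have "sublist [Letter x, Letter y] (unmarked w) \<longleftrightarrow> sublist [x, y] w" for x y
    using sublist_map_iff[of Letter "[x, y]" w] by (simp add: unmarked_def)
  then show ?thesis
    by (simp add: segmentwise_reduced_def freely_reduced_iff_sublist)
qed

lemma segmentwise_reduced_append_Marked_iff:
  "segmentwise_reduced (V @ Marked m # W) \<longleftrightarrow> segmentwise_reduced V \<and> segmentwise_reduced W"
  by (auto simp: segmentwise_reduced_def sublist_append_Cons_iff)

lemma marked_product_0: "marked_product 0 v r e = unmarked (v 1)"
  by (simp add: marked_product_def)

lemma marked_product_Suc:
  "marked_product (Suc N) v r e =
     marked_product N v r e @ Marked (signed_word (r (Suc N)) (e (Suc N)))
       # unmarked (v (Suc (Suc N)))"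
  by (simp add: marked_product_def)

lemma segmentwise_reduced_marked_product_iff:
  "segmentwise_reduced (marked_product N v r e) \<longleftrightarrow> (\<forall>i\<in>{1..Suc N}. freely_reduced (v i))"
proof (induction N)
  case 0
  show ?case by (simp add: marked_product_0 segmentwise_reduced_unmarked_iff)
next
  case (Suc N)
  then show ?case
    by (auto simp: marked_product_Suc segmentwise_reduced_append_Marked_iff
        segmentwise_reduced_unmarked_iff atLeastAtMostSuc_conv)
qed

theorem theorem1:
  fixes S :: "'a set" and R :: "'a word set" and U :: "'a marked_word"
  assumes "finite S"
    and "finite R"
    and "R \<subseteq> words_over S"
    and "reduced_proof_word S R U"
  shows "\<exists>W. (move S R)\<^sup>*\<^sup>* [] W \<and> segmentwise_free_reduction W U"
proof -
  from assms(4) obtain N u r e where "1 \<le> N"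
    and factors: "\<forall>i\<in>{1..N}. r i \<in> R \<and> u i \<in> free_group_elements S"
    and U: "U = proof_word N u r e"
    and reduced: "\<forall>i\<in>{1..Suc N}. freely_reduced (segment N u i)"
    unfolding reduced_proof_word_def by blast
  have "generated S R U"
    unfolding U using factors
    by (intro generated_proof_word) (auto simp: free_group_elements_def)
  moreover have "segmentwise_reduced U"
    unfolding U proof_word_eq_marked_product[OF \<open>1 \<le> N\<close>]
    using reduced by (simp only: segmentwise_reduced_marked_product_iff)
  ultimately show ?thesis
    unfolding generated_def segmentwise_reduced_iff_no_cancel_step segmentwise_free_reduction_def
    by blast
qed

end
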